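(* Let $p$ be an odd prime, $n=2p$, and let $\zeta_n$ be a primitive $n$-th root of unity in $\mathbf{C}$. Let $I,J\subseteq \mathbf{Z}_n=\{0,1,\dots,n-1\}$ satisfy $|I_2^k|=|J_2^k|$ for $k=0,1$. Then the matrix $(\zeta_n^{ij})_{i\in I,\, j\in J}$ has nonzero determinant.
   Context: Via the group isomorphism $\mathbf{Z}_p\times\mathbf{Z}_2\to\mathbf{Z}_{2p}$, $(i_p,i_2)\mapsto i\equiv 2i_p+p\,i_2 \pmod{2p}$, every $i\in\mathbf{Z}_{2p}$ has components $i_p\in\mathbf{Z}_p$ and $i_2\in\mathbf{Z}_2$ (here $i_2\equiv i \pmod 2$). For $I\subseteq\mathbf{Z}_{2p}$ and $k\in\{0,1\}$, $I_2^k=\{i\in I: i_2=k\}$. (The hypothesis forces $|I|=|J|$, so the matrix is square.) *)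

theory Defs
  imports
    "Jordan_Normal_Form.Determinant"
    "Jordan_Normal_Form.DL_Submatrix"
    "HOL-Computational_Algebra.Primes"
    Complex_Main
begin

(* Residue classes modulo m are represented by {0..<m} throughout. *)

definition crt_map :: "nat \<Rightarrow> nat \<times> nat \<Rightarrow> nat" where
  "crt_map p = (\<lambda>(a, b). (2 * a + p * b) mod (2 * p))"

(* The components (i_p, i_2) of i; meaningful when crt_map p is a bijection, see bij_betw_crt_map. *)
definition crt_components :: "nat \<Rightarrow> nat \<Rightarrow> nat \<times> nat" where
  "crt_components p = the_inv_into ({0..<p} \<times> {0..<2}) (crt_map p)"

definition component_p :: "nat \<Rightarrow> nat \<Rightarrow> nat" where
  "component_p p i = fst (crt_components p i)"

definition component_2 :: "nat \<Rightarrow> nat \<Rightarrow> nat" where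
  "component_2 p i = snd (crt_components p i)"

definition part_2 :: "nat \<Rightarrow> nat set \<Rightarrow> nat \<Rightarrow> nat set" where
  "part_2 p I k = {i \<in> I. component_2 p i = k}"

definition primitive_root_of_unity :: "nat \<Rightarrow> complex \<Rightarrow> bool" where
  "primitive_root_of_unity n z \<longleftrightarrow> n > 0 \<and> z ^ n = 1 \<and> (\<forall>k. 0 < k \<and> k < n \<longrightarrow> z ^ k \<noteq> 1)"

definition fourier_mat :: "nat \<Rightarrow> complex \<Rightarrow> complex mat" where
  "fourier_mat n z = mat n n (\<lambda>(i, j). z ^ (i * j))"

(* Rows and columns are listed in increasing order; reordering only changes the sign of the
   determinant. *)
definition fourier_minor :: "nat \<Rightarrow> complex \<Rightarrow> nat set \<Rightarrow> nat set \<Rightarrow> complex mat" where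
  "fourier_minor n z I J = submatrix (fourier_mat n z) I J"

lemma crt_map_add:
  "crt_map p ((a + c) mod p, (b + d) mod 2) = (crt_map p (a, b) + crt_map p (c, d)) mod (2 * p)"
proof -
  have 1: "2 * ((a + c) mod p) = (2 * (a + c)) mod (2 * p)"
    by (rule mult_mod_right)
  have 2: "p * ((b + d) mod 2) = (p * (b + d)) mod (2 * p)"
    by (metis mult_mod_right mult.commute)
  have 3: "2 * (a + c) + p * (b + d) = (2 * a + p * b) + (2 * c + p * d)"
    by (simp add: algebra_simps)
  show ?thesis
    unfolding crt_map_def prod.case 1 2 mod_add_eq 3 ..
qed

lemma crt_map_mod_2:
  assumes "odd p" "b < 2"
  shows "crt_map p (a, b) mod 2 = b"
proof -
  have "crt_map p (a, b) mod 2 = (2 * a + p * b) mod 2"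
    unfolding crt_map_def prod.case by (rule mod_mod_cancel) simp
  also have "\<dots> = b"
    using assms by (cases "b = 0") (auto simp: less_2_cases_iff mod2_eq_if)
  finally show ?thesis .
qed

lemma bij_betw_crt_map:
  assumes "odd p"
  shows "bij_betw (crt_map p) ({0..<p} \<times> {0..<2}) {0..<2 * p}"
proof -
  have p: "p > 0" using assms by (auto intro: Nat.gr0I)
  have inj: "inj_on (crt_map p) ({0..<p} \<times> {0..<2})"
  proof (rule inj_onI, clarify)
    fix a b c d
    assume ab: "a \<in> {0..<p}" "b \<in> {0..<2}" and cd: "c \<in> {0..<p}" "d \<in> {0..<2}"
      and eq: "crt_map p (a, b) = crt_map p (c, d)"
    have bd: "b = d"
      using crt_map_mod_2[OF assms] ab cd eq by (metis atLeastLessThan_iff)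
    have "(2 * x + p * b + p * b) mod (2 * p) = 2 * x" if "x < p" for x
    proof -
      have "2 * x + p * b + p * b = 2 * x + b * (2 * p)" by (simp add: algebra_simps)
      then show ?thesis using that by (simp only: mod_mult_self1) simp
    qed
    moreover have "(2 * a + p * b + p * b) mod (2 * p) = (2 * c + p * b + p * b) mod (2 * p)"
      by (rule mod_add_cong[OF _ refl]) (use eq bd in \<open>simp only: crt_map_def prod.case\<close>)
    ultimately have "2 * a = 2 * c" using ab cd by simp
    then have "a = c" by simp
    then show "a = c \<and> b = d" using bd by simp
  qed
  have "crt_map p ` ({0..<p} \<times> {0..<2}) = {0..<2 * p}"
  proof (rule card_subset_eq)
    show "crt_map p ` ({0..<p} \<times> {0..<2}) \<subseteq> {0..<2 * p}"
      using p by (auto simp: crt_map_def)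
    show "card (crt_map p ` ({0..<p} \<times> {0..<2})) = card {0..<2 * p}"
      by (simp add: card_image[OF inj])
  qed simp
  then show ?thesis using inj by (simp add: bij_betw_def)
qed

lemma component_2_eq_mod_2:
  assumes "odd p" "i < 2 * p"
  shows "component_2 p i = i mod 2"
proof -
  have "i \<in> crt_map p ` ({0..<p} \<times> {0..<2})"
    using bij_betw_crt_map[OF assms(1)] assms(2) by (auto simp: bij_betw_def)
  then obtain a b where ab: "a < p" "b < 2" "i = crt_map p (a, b)" by auto
  have "crt_components p i = (a, b)"
    unfolding crt_components_def ab(3)
    by (rule the_inv_into_f_f) (use bij_betw_crt_map[OF assms(1)] ab in \<open>auto simp: bij_betw_def\<close>)
  then show ?thesis
    using crt_map_mod_2[OF assms(1) ab(2)] ab(3) by (simp add: component_2_def)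
qed

end

theory Submission
  imports Defs "Jordan_Normal_Form.Char_Poly" "HOL-Number_Theory.Cong"
begin

text \<open>
  Put $w = -\zeta$, so $w^p = 1$ and $\zeta^{ij} = (-1)^{ij} w^{ij}$. A kernel vector $u$ gives
  $f_0 = \sum u_j X^j$ (even $j$) and $f_1 = \sum u_j X^j$ (odd $j$) such that $f_0 + f_1$ vanishes
  at $w^i$ for even $i \in I$ and $f_0 - f_1$ at $w^i$ for odd $i \in I$. Newton interpolation at these
  nodes turns the vanishing into linear relations for $u$ over $\mathbf{Z}[w]$, whose coefficients
  become, under $w \mapsto 1$, the values $\pm q(j)$ of an arbitrary integer polynomial $q$ of degree
  less than the number of nodes. Suppose there are at least as many even as odd indices; the other case
  follows by changing the sign of $f_0$. Choosing for $q$ the nodal polynomials of the even and of the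
  odd part of $J$ gives a square system that is triangular at $w = 1$ with diagonal prime to $p$. Its
  determinant $D(w)$ is nonzero, because $D(w) = 0$ with $D \in \mathbf{Z}[X]$ forces $p \mid D(1)$.
\<close>

section \<open>Evaluation of integer polynomials and determinants modulo an integer\<close>

abbreviation ev :: "complex \<Rightarrow> int poly \<Rightarrow> complex" where
  "ev z q \<equiv> poly (of_int_poly q) z"

lemma comm_ring_hom_ev: "comm_ring_hom (ev z)"
  by unfold_locales (auto simp: hom_distribs)

lemma comm_ring_hom_poly: "comm_ring_hom (\<lambda>q :: 'a :: comm_ring_1 poly. poly q a)"
  by unfold_locales auto

text \<open>The Leibniz formula expresses the determinant by sums and products of entries, so
  entrywise congruences pass to it.\<close>

lemma det_cong_mod:
  fixes m :: int and f g :: "nat \<Rightarrow> nat \<Rightarrow> int"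
  assumes "\<And>i j. i < n \<Longrightarrow> j < n \<Longrightarrow> f i j mod m = g i j mod m"
  shows "det (mat n n (\<lambda>(i, j). f i j)) mod m = det (mat n n (\<lambda>(i, j). g i j)) mod m"
proof -
  have *: "(\<Prod>i = 0..<n. mat n n (\<lambda>(i, j). f i j) $$ (i, \<pi> i)) mod m =
        (\<Prod>i = 0..<n. mat n n (\<lambda>(i, j). g i j) $$ (i, \<pi> i)) mod m"
    if "\<pi> permutes {0..<n}" for \<pi>
  proof -
    have lt: "\<pi> i < n" if "i < n" for i
      using permutes_in_image[OF \<open>\<pi> permutes _\<close>, of i] that by simp
    have "(\<Prod>i = 0..<n. f i (\<pi> i)) mod m = (\<Prod>i = 0..<n. f i (\<pi> i) mod m) mod m"
      by (simp add: mod_prod_eq)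
    also have "\<dots> = (\<Prod>i = 0..<n. g i (\<pi> i) mod m) mod m"
      using assms lt by simp
    also have "\<dots> = (\<Prod>i = 0..<n. g i (\<pi> i)) mod m"
      by (simp add: mod_prod_eq)
    finally show ?thesis using lt by simp
  qed
  let ?P = "{\<pi>. \<pi> permutes {0..<n}}"
  let ?F = "\<lambda>h \<pi>. signof \<pi> * (\<Prod>i = 0..<n. mat n n (\<lambda>(i, j). h i j) $$ (i, \<pi> i)) :: int"
  have "(\<Sum>\<pi>\<in>?P. ?F f \<pi>) mod m = (\<Sum>\<pi>\<in>?P. ?F f \<pi> mod m) mod m"
    by (simp add: mod_sum_eq)
  also have "\<dots> = (\<Sum>\<pi>\<in>?P. ?F g \<pi> mod m) mod m"
    by (rule arg_cong[where f = "\<lambda>x. x mod m"], rule sum.cong[OF refl], rule mod_mult_cong[OF refl *])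
      simp
  also have "\<dots> = (\<Sum>\<pi>\<in>?P. ?F g \<pi>) mod m"
    by (simp add: mod_sum_eq)
  finally show ?thesis
    by (simp add: det_def'[of _ n])
qed

section \<open>Divisibility by \<open>p\<close> in Z[w]\<close>

text \<open>Grouping exponents by their residue modulo \<open>n\<close> shows that the powers of
  \<open>w\<close> below \<open>n\<close> span Z[w] over the integers.\<close>

lemma ev_root_of_unity_reduce:
  fixes w :: complex
  assumes "w ^ n = 1" "n > 0"
  shows "\<exists>h :: nat \<Rightarrow> int. ev w S = (\<Sum>j<n. of_int (h j) * w ^ j)"
proof -
  have red: "w ^ k = w ^ (k mod n)" for k
  proof -
    have "w ^ k = w ^ (n * (k div n) + k mod n)" by simp
    also have "\<dots> = w ^ (k mod n)" unfolding power_add power_mult assms(1) by simp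
    finally show ?thesis .
  qed
  let ?h = "\<lambda>j. \<Sum>k\<in>{k \<in> {..degree S}. k mod n = j}. coeff S k"
  have "ev w S = (\<Sum>k\<le>degree S. of_int (coeff S k) * w ^ k)"
    by (subst poly_altdef) simp
  also have "\<dots> = (\<Sum>j<n. \<Sum>k\<in>{k \<in> {..degree S}. k mod n = j}. of_int (coeff S k) * w ^ k)"
    by (rule sum.group[symmetric]) (use assms in auto)
  also have "\<dots> = (\<Sum>j<n. of_int (?h j) * w ^ j)"
  proof (rule sum.cong[OF refl])
    fix j
    have "(\<Sum>k\<in>{k \<in> {..degree S}. k mod n = j}. of_int (coeff S k) * w ^ k)
        = (\<Sum>k\<in>{k \<in> {..degree S}. k mod n = j}. of_int (coeff S k) * w ^ j)"
      by (rule sum.cong[OF refl]) (use red in auto)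
    then show "(\<Sum>k\<in>{k \<in> {..degree S}. k mod n = j}. of_int (coeff S k) * w ^ k) = of_int (?h j) * w ^ j"
      by (simp add: sum_distrib_right)
  qed
  finally show ?thesis by (intro exI[of _ ?h])
qed

text \<open>Multiplication by $c - p\,S(w) = 0$ acts on the vector of powers of $w$ by an integer matrix that
  is congruent to $c$ times the identity modulo $p$.\<close>
lemma root_of_unity_multiple_imp_dvd:
  fixes w :: complex and c :: int
  assumes w: "w ^ n = 1" "n > 0" and p: "prime p" and eq: "of_int c = of_nat p * ev w S"
  shows "int p dvd c"
proof -
  interpret h: comm_ring_hom "ev w" by (rule comm_ring_hom_ev)
  have "\<exists>B. \<forall>i. ev w (S * monom 1 i) = (\<Sum>j<n. of_int (B i j :: int) * w ^ j)"
    by (intro choice allI ev_root_of_unity_reduce w)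
  then obtain B where "\<And>i. ev w (S * monom 1 i) = (\<Sum>j<n. of_int (B i j :: int) * w ^ j)"
    by blast
  then have B: "ev w S * w ^ i = (\<Sum>j<n. of_int (B i j) * w ^ j)" for i
    by (simp add: h.hom_mult poly_monom)
  define F where "F i j = (if i = j then c else 0) - int p * B i j" for i j
  let ?M = "mat n n (\<lambda>(i, j). F i j)"
  let ?C = "map_mat of_int ?M :: complex mat"
  let ?v = "vec n (\<lambda>j. w ^ j)"
  have "?C *\<^sub>v ?v = 0\<^sub>v n"
  proof (rule eq_vecI)
    fix i assume "i < dim_vec (0\<^sub>v n :: complex vec)"
    then have i: "i < n" by simp
    have "(?C *\<^sub>v ?v) $ i = (\<Sum>j<n. of_int (F i j) * w ^ j)"
      using i by (simp add: scalar_prod_def atLeast0LessThan)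
    also have "\<dots> = (\<Sum>j<n. (if i = j then of_int c * w ^ i else 0)) - of_nat p * (\<Sum>j<n. of_int (B i j) * w ^ j)"
      unfolding sum_distrib_left sum_subtractf[symmetric]
      by (rule sum.cong) (auto simp: F_def algebra_simps)
    also have "\<dots> = of_int c * w ^ i - of_nat p * (ev w S * w ^ i)"
      using i by (simp add: B)
    also have "\<dots> = 0" by (simp add: eq)
    finally show "(?C *\<^sub>v ?v) $ i = 0\<^sub>v n $ i" using i by simp
  qed simp
  \<comment> \<open>Entry 0 of the vector is \<open>w ^ 0 = 1\<close>; it exists because
    \<open>n > 0\<close>.\<close>
  moreover have "?v \<noteq> 0\<^sub>v n"
    using w(2) by (metis index_vec index_zero_vec(1) power_0 zero_neq_one)
  ultimately have "det ?C = 0"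
    by (subst det_0_iff_vec_prod_zero[of _ n]) (auto intro!: exI[of _ ?v])
  then have "det ?M = 0" by (simp add: of_int_hom.hom_det)
  moreover have "det ?M mod int p = det (mat n n (\<lambda>(i, j). if i = j then c else 0)) mod int p"
    by (rule det_cong_mod) (simp add: F_def mod_diff_eq[symmetric])
  moreover have "mat n n (\<lambda>(i, j). if i = j then c else 0) = c \<cdot>\<^sub>m 1\<^sub>m n"
    by (rule eq_matI) auto
  ultimately have "int p dvd c ^ n" by (simp add: det_smult mod_0_imp_dvd dvd_eq_mod_eq_0)
  then show ?thesis using p by (metis prime_dvd_power prime_nat_int_transfer)
qed

text \<open>In the binomial expansion the outer terms \<open>w ^ p = 1\<close> and
  \<open>(-1) ^ p = -1\<close> cancel, and \<open>p\<close> divides all inner coefficients.\<close>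

lemma minus_one_power_prime:
  fixes w :: complex
  assumes "prime p" "odd p" "w ^ p = 1"
  shows "\<exists>S. (w - 1) ^ p = of_nat p * ev w S"
proof -
  let ?c = "\<lambda>k. int ((p choose k) div p) * (- 1) ^ (p - k)"
  have p0: "p > 0" using assms prime_gt_0_nat by blast
  have dv: "of_nat (p choose k) = (of_nat p * of_nat ((p choose k) div p) :: complex)" if "k \<in> {1..<p}" for k
    using dvd_choose_prime[of k p] that assms(1) by (simp flip: of_nat_mult)
  have "(w - 1) ^ p = (\<Sum>k\<le>p. of_nat (p choose k) * w ^ k * (- 1) ^ (p - k))"
    using binomial_ring[of w "-1" p] by simp
  also have "{..p} = insert 0 (insert p {1..<p})" using p0 by auto
  also have "(\<Sum>k\<in>\<dots>. of_nat (p choose k) * w ^ k * (- 1) ^ (p - k)) =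
     (\<Sum>k\<in>{1..<p}. of_nat (p choose k) * w ^ k * (- 1) ^ (p - k))"
    using p0 assms by simp
  also have "\<dots> = of_nat p * (\<Sum>k\<in>{1..<p}. of_int (?c k) * w ^ k)"
    unfolding sum_distrib_left by (rule sum.cong[OF refl]) (simp add: dv)
  also have "(\<Sum>k\<in>{1..<p}. of_int (?c k) * w ^ k) = ev w (\<Sum>k\<in>{1..<p}. monom (?c k) k)"
    by (simp add: hom_distribs poly_sum poly_monom)
  finally show ?thesis by blast
qed

text \<open>Since D(w) is congruent to D(1) modulo w - 1, the integer D(1) is a multiple of w - 1 in
  Z[w]. Its p-th power is then in p Z[w], and an integer there is divisible by
  \<open>p\<close>.\<close>

lemma ev_root_of_unity_eq_0_imp_dvd:
  fixes w :: complex
  assumes p: "prime p" "odd p" and w: "w ^ p = 1" and D: "ev w D = 0"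
  shows "int p dvd poly D 1"
proof -
  interpret h: comm_ring_hom "ev w" by (rule comm_ring_hom_ev)
  obtain S where S: "(w - 1) ^ p = of_nat p * ev w S"
    using minus_one_power_prime[OF p w] by blast
  \<comment> \<open>The quotient of \<open>D\<close> by X - 1; the remainder is D(1).\<close>
  define E where "E = synthetic_div D 1"
  have "D + smult 1 E = pCons (poly D 1) E"
    unfolding E_def by (rule synthetic_div_correct)
  then have "D = [:poly D 1:] + [:-1, 1:] * E" by (simp add: algebra_simps)
  then have "ev w D = ev w ([:poly D 1:] + [:-1, 1:] * E)" by simp
  then have "ev w D = of_int (poly D 1) + (w - 1) * ev w E"
    by (simp only: h.hom_add h.hom_mult) (simp add: hom_distribs)
  then have "of_int (poly D 1) = (w - 1) * - ev w E" using D by (simp add: add_eq_0_iff2)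
  then have "of_int (poly D 1) ^ p = (w - 1) ^ p * (- ev w E) ^ p"
    unfolding power_mult_distrib[symmetric] by simp
  then have "of_int (poly D 1 ^ p) = of_nat p * ev w (S * (- E) ^ p)"
    by (simp add: S h.hom_mult h.hom_power h.hom_uminus)
  then have "int p dvd poly D 1 ^ p"
    by (rule root_of_unity_multiple_imp_dvd[OF w prime_gt_0_nat[OF p(1)] p(1)])
  then show ?thesis using p by (metis prime_dvd_power prime_nat_int_transfer)
qed

section \<open>Linear systems over Z[w] that are triangular at w = 1\<close>

text \<open>A nonzero kernel vector makes the determinant D of the polynomial matrix
  \<open>R\<close> vanish at \<open>w\<close>. Then \<open>p\<close> divides D(1), which is the
  product of diagonal values prime to \<open>p\<close>.\<close>

lemma kernel_trivial_if_upper_triangular_at_1: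
  fixes w :: complex and R :: "nat \<Rightarrow> nat \<Rightarrow> int poly"
  assumes p: "prime p" "odd p" and w: "w ^ p = 1"
    and rows: "\<And>i. i < N \<Longrightarrow> (\<Sum>j<N. ev w (R i j) * u j) = 0"
    and tri: "\<And>i j. j < i \<Longrightarrow> i < N \<Longrightarrow> poly (R i j) 1 = 0"
    and diag: "\<And>i. i < N \<Longrightarrow> \<not> int p dvd poly (R i i) 1"
    and j: "j < N"
  shows "u j = 0"
proof (rule ccontr)
  assume "u j \<noteq> 0"
  let ?M = "mat N N (\<lambda>(i, j). R i j)"
  let ?v = "vec N u"
  have "map_mat (ev w) ?M *\<^sub>v ?v = 0\<^sub>v N"
    by (rule eq_vecI) (auto simp: scalar_prod_def atLeast0LessThan rows)
  moreover have "?v \<noteq> 0\<^sub>v N"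
    using j \<open>u j \<noteq> 0\<close> by (metis index_vec index_zero_vec(1))
  ultimately have "det (map_mat (ev w) ?M) = 0"
    by (subst det_0_iff_vec_prod_zero[of _ N]) (auto intro!: exI[of _ ?v])
  then have "ev w (det ?M) = 0"
    by (simp add: comm_ring_hom.hom_det[OF comm_ring_hom_ev])
  then have "int p dvd poly (det ?M) 1"
    by (rule ev_root_of_unity_eq_0_imp_dvd[OF p w])
  also have "poly (det ?M) 1 = det (map_mat (\<lambda>q. poly q 1) ?M)"
    by (simp add: comm_ring_hom.hom_det[OF comm_ring_hom_poly])
  also have "\<dots> = (\<Prod>i<N. poly (R i i) 1)"
    by (subst det_upper_triangular[of _ N])
      (auto simp: upper_triangular_def tri prod_list_diag_prod atLeast0LessThan)
  finally show False
    using diag p(1) by (auto simp: prime_dvd_prod_iff)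
qed

section \<open>Newton interpolation at powers of \<open>w\<close>\<close>

text \<open>The divided difference of $X^c$ at $w^{a_0}, \dots, w^{a_k}$ as a polynomial in $w$; the recursion
  comes from $X N_k = N_{k+1} + w^{a_k} N_k$ for the Newton basis $N_k = \prod_{i<k} (X - w^{a_i})$.\<close>
primrec newton_coeff :: "(nat \<Rightarrow> nat) \<Rightarrow> nat \<Rightarrow> nat \<Rightarrow> int poly" where
  "newton_coeff a 0 k = (if k = 0 then 1 else 0)"
| "newton_coeff a (Suc c) k =
    monom 1 (a k) * newton_coeff a c k + (case k of 0 \<Rightarrow> 0 | Suc l \<Rightarrow> newton_coeff a c l)"

lemma newton_coeff_eq_0: "c < k \<Longrightarrow> newton_coeff a c k = 0"
  by (induction c arbitrary: k) (auto split: nat.splits)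

text \<open>At w = 1 the recursion becomes Pascal's rule, whatever the nodes are.\<close>

lemma poly_newton_coeff_1: "poly (newton_coeff a c k) 1 = int (c choose k)"
  by (induction c arbitrary: k) (auto simp: poly_monom split: nat.splits)

lemma newton_expansion:
  fixes w z :: complex
  assumes "c < M"
  shows "z ^ c = (\<Sum>k<M. ev w (newton_coeff a c k) * (\<Prod>i<k. z - w ^ a i))"
  using assms
proof (induction c arbitrary: M)
  case 0
  have "(\<Sum>k<M. ev w (newton_coeff a 0 k) * (\<Prod>i<k. z - w ^ a i)) = (\<Sum>k<M. if k = 0 then 1 else 0)"
    by (rule sum.cong) auto
  then show ?case using 0 by simp
next
  case (Suc c)
  interpret h: comm_ring_hom "ev w" by (rule comm_ring_hom_ev)
  obtain M' where M: "M = Suc M'" "c < M'" using Suc.prems by (cases M) auto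
  let ?e = "\<lambda>k. ev w (newton_coeff a c k)" and ?N = "\<lambda>k. \<Prod>i<k. z - w ^ a i"
  have "(\<Sum>k<M. ev w (newton_coeff a (Suc c) k) * ?N k) =
     (\<Sum>k<Suc M'. w ^ a k * ?e k * ?N k) + (\<Sum>k<Suc M'. ev w (case k of 0 \<Rightarrow> 0 | Suc l \<Rightarrow> newton_coeff a c l) * ?N k)"
    unfolding M newton_coeff.simps h.hom_add h.hom_mult
    by (simp add: poly_monom algebra_simps flip: sum.distrib)
  \<comment> \<open>The top term \<open>k = M'\<close> drops out because \<open>c < M'\<close>; the
    other sum loses its term \<open>k = 0\<close> instead, and after an index shift both have the
    same range.\<close>
  also have "(\<Sum>k<Suc M'. w ^ a k * ?e k * ?N k) = (\<Sum>k<M'. w ^ a k * ?e k * ?N k)"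
    using M by (simp add: newton_coeff_eq_0)
  also have "(\<Sum>k<Suc M'. ev w (case k of 0 \<Rightarrow> 0 | Suc l \<Rightarrow> newton_coeff a c l) * ?N k) =
      (\<Sum>k<M'. ?e k * (?N k * (z - w ^ a k)))"
    unfolding sum.lessThan_Suc_shift by simp
  also have "(\<Sum>k<M'. w ^ a k * ?e k * ?N k) + \<dots> = z * (\<Sum>k<M'. ?e k * ?N k)"
    unfolding sum_distrib_left sum.distrib[symmetric] by (rule sum.cong) (auto simp: algebra_simps)
  also have "\<dots> = z * z ^ c" using Suc.IH[OF M(2)] by simp
  finally show ?case by simp
qed

text \<open>The left-hand side is the Newton coefficient number \<open>m\<close> of the sum of
  \<open>c j\<close> X^j. At node number \<open>m\<close>, basis products with larger index vanish,
  coefficients with smaller index are zero by induction, and the product of index \<open>m\<close>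
  is nonzero since the nodes are distinct.\<close>

lemma newton_coeff_sum_eq_0:
  fixes w :: complex
  assumes J: "finite J"
    and inj: "inj_on (\<lambda>i. w ^ a i) {..<r}"
    and van: "\<And>i. i < r \<Longrightarrow> (\<Sum>j\<in>J. c j * (w ^ a i) ^ j) = 0"
    and "m < r"
  shows "(\<Sum>j\<in>J. c j * ev w (newton_coeff a j m)) = 0"
  using \<open>m < r\<close>
proof (induction m rule: less_induct)
  case (less m)
  obtain M0 where M0: "\<And>j. j \<in> J \<Longrightarrow> j < M0"
    using J by (metis finite_nat_set_iff_bounded)
  \<comment> \<open>\<open>M\<close> exceeds every exponent in \<open>J\<close>, so that all
    expansions apply, and also \<open>m\<close>, so that the term \<open>k = m\<close>
    occurs.\<close>
  define M where "M = max M0 (Suc m)"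
  let ?g = "\<lambda>k. \<Sum>j\<in>J. c j * ev w (newton_coeff a j k)"
  let ?N = "\<lambda>k. \<Prod>i<k. w ^ a m - w ^ a i"
  have "0 = (\<Sum>j\<in>J. c j * (w ^ a m) ^ j)" using van less.prems by simp
  also have "\<dots> = (\<Sum>j\<in>J. c j * (\<Sum>k<M. ev w (newton_coeff a j k) * ?N k))"
    using M0 by (intro sum.cong refl arg_cong2[where f = times] newton_expansion)
      (auto simp: M_def less_max_iff_disj)
  also have "\<dots> = (\<Sum>k<M. ?g k * ?N k)"
    unfolding sum_distrib_left sum_distrib_right by (subst sum.swap) (simp add: mult.assoc)
  also have "\<dots> = (\<Sum>k<M. if k = m then ?g m * ?N m else 0)"
  proof (rule sum.cong[OF refl])
    fix k
    consider "k < m" | "k = m" | "k > m" by linarith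
    then show "?g k * ?N k = (if k = m then ?g m * ?N m else 0)"
    proof cases
      case 1
      then show ?thesis using less by simp
    next
      case 3
      then have "?N k = 0" by auto
      then show ?thesis using 3 by simp
    qed simp
  qed
  also have "\<dots> = ?g m * ?N m" by (simp add: M_def)
  finally have "?g m * ?N m = 0" by simp
  moreover have "?N m \<noteq> 0"
    using less.prems inj by (auto dest!: inj_onD)
  ultimately show ?case by simp
qed

section \<open>Integer polynomials in the binomial basis\<close>

text \<open>This describes multiplication by the variable in the binomial basis.\<close>

lemma mult_choose_eq: "c * (c choose k) = Suc k * (c choose Suc k) + k * (c choose k)"
proof (induction c arbitrary: k)
  case 0
  show ?case by (cases k) auto
next
  case (Suc c)
  show ?case
  proof (cases k)
    case (Suc l)
    then show ?thesis using Suc.IH[of k] Suc.IH[of l] by (simp add: algebra_simps)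
  qed simp
qed

lemma poly_eq_sum_choose:
  fixes q :: "int poly"
  assumes "degree q < r"
  shows "\<exists>L :: nat \<Rightarrow> int. \<forall>c :: nat. poly q (int c) = (\<Sum>k<r. L k * int (c choose k))"
  using assms
proof (induction q arbitrary: r)
  case 0
  show ?case by (intro exI[of _ "\<lambda>_. 0"]) simp
next
  case (pCons a q)
  obtain s where s: "r = Suc s" using pCons.prems by (cases r) auto
  have "\<exists>L :: nat \<Rightarrow> int. \<forall>c :: nat. poly q (int c) = (\<Sum>k<s. L k * int (c choose k))"
  proof (cases "q = 0")
    case True
    then show ?thesis by (intro exI[of _ "\<lambda>_. 0"]) simp
  next
    case False
    then show ?thesis using pCons s by simp
  qed
  then obtain L :: "nat \<Rightarrow> int" where L: "\<And>c :: nat. poly q (int c) = (\<Sum>k<s. L k * int (c choose k))"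
    by blast
  \<comment> \<open>Coefficients of a + X q: index \<open>k\<close> receives \<open>k\<close> times
    the old coefficients of indices \<open>k - 1\<close> and \<open>k\<close>, and index 0 receives
    \<open>a\<close>. The guard excludes \<open>L s\<close>, which lies outside the old sum.\<close>
  let ?L = "\<lambda>k. (case k of 0 \<Rightarrow> a | Suc l \<Rightarrow> int k * L l) + (if k < s then int k * L k else 0)"
  have "poly (pCons a q) (int c) = (\<Sum>k<r. ?L k * int (c choose k))" for c
  proof -
    have "(\<Sum>k<r. ?L k * int (c choose k)) = (\<Sum>k<Suc s. (case k of 0 \<Rightarrow> a | Suc l \<Rightarrow> int k * L l) * int (c choose k))
        + (\<Sum>k<Suc s. (if k < s then int k * L k else 0) * int (c choose k))"
      by (simp only: s distrib_right sum.distrib)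
    also have "(\<Sum>k<Suc s. (case k of 0 \<Rightarrow> a | Suc l \<Rightarrow> int k * L l) * int (c choose k))
        = a + (\<Sum>k<s. int (Suc k) * L k * int (c choose Suc k))"
      unfolding sum.lessThan_Suc_shift by simp
    also have "(\<Sum>k<Suc s. (if k < s then int k * L k else 0) * int (c choose k))
        = (\<Sum>k<s. int k * L k * int (c choose k))"
      by simp
    also have "a + (\<Sum>k<s. int (Suc k) * L k * int (c choose Suc k)) + \<dots>
        = a + (\<Sum>k<s. L k * int (Suc k * (c choose Suc k) + k * (c choose k)))"
      by (simp add: sum.distrib[symmetric] algebra_simps)
    also have "\<dots> = poly (pCons a q) (int c)"
      unfolding mult_choose_eq[symmetric] by (simp add: L sum_distrib_left algebra_simps)
    finally show ?thesis by simp
  qed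
  then show ?case by (intro exI[of _ ?L]) simp
qed

text \<open>Each Newton coefficient gives a relation that specializes at w = 1 to a binomial
  coefficient. Integer combinations of them reach every integer polynomial of degree below the
  number of nodes.\<close>

lemma vanishing_imp_relation:
  fixes w :: complex and q :: "int poly"
  assumes J: "finite J" and A: "finite A" "inj_on (\<lambda>a. w ^ a) A"
    and van: "\<And>a. a \<in> A \<Longrightarrow> (\<Sum>j\<in>J. c j * (w ^ a) ^ j) = 0"
    and q: "degree q < card A"
  obtains E where "(\<Sum>j\<in>J. c j * ev w (E j)) = 0" "\<And>j. poly (E j) 1 = poly q (int j)"
proof -
  obtain L :: "nat \<Rightarrow> int" where L: "\<And>c :: nat. poly q (int c) = (\<Sum>k<card A. L k * int (c choose k))"
    using poly_eq_sum_choose[OF q] by blast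
  obtain a where a: "bij_betw a {..<card A} A"
    using ex_bij_betw_nat_finite[OF A(1)] by (auto simp: atLeast0LessThan)
  then have inj: "inj_on (\<lambda>i. w ^ a i) {..<card A}"
    using comp_inj_on[of a "{..<card A}" "\<lambda>a. w ^ a"] A(2) by (simp add: bij_betw_def o_def)
  have aA: "a i \<in> A" if "i < card A" for i using a that by (auto simp: bij_betw_def)
  define E where "E j = (\<Sum>k<card A. smult (L k) (newton_coeff a j k))" for j
  show ?thesis
  proof
    have "(\<Sum>j\<in>J. c j * ev w (E j)) = (\<Sum>j\<in>J. \<Sum>k<card A. of_int (L k) * (c j * ev w (newton_coeff a j k)))"
      by (simp add: E_def hom_distribs poly_sum sum_distrib_left algebra_simps)
    also have "\<dots> = (\<Sum>k<card A. of_int (L k) * (\<Sum>j\<in>J. c j * ev w (newton_coeff a j k)))"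
      by (subst sum.swap) (simp add: sum_distrib_left)
    also have "\<dots> = 0"
      using newton_coeff_sum_eq_0[OF J inj van] aA by simp
    finally show "(\<Sum>j\<in>J. c j * ev w (E j)) = 0" .
    show "poly (E j) 1 = poly q (int j)" for j
      by (simp add: E_def poly_sum poly_newton_coeff_1 L)
  qed
qed

section \<open>Nodal polynomials\<close>

text \<open>The Lagrange basis polynomial without its denominator: this keeps the coefficients
  integral, and the value at \<open>j\<close> only has to be prime to \<open>p\<close>.\<close>

definition nodal :: "nat set \<Rightarrow> nat \<Rightarrow> int poly" where
  "nodal K j = (\<Prod>i\<in>K - {j}. [:- int i, 1:])"

lemma degree_nodal:
  assumes "finite K" "j \<in> K"
  shows "degree (nodal K j) < card K"
proof -
  have "degree (nodal K j) = (\<Sum>i\<in>K - {j}. degree [:- int i, 1:])"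
    unfolding nodal_def by (rule degree_prod_eq_sum_degree) auto
  also have "\<dots> < card K" using assms by (simp add: card_Diff1_less del: card_Diff_insert)
  finally show ?thesis .
qed

lemma poly_nodal_eq_0: "finite K \<Longrightarrow> i \<in> K \<Longrightarrow> i \<noteq> j \<Longrightarrow> poly (nodal K j) (int i) = 0"
  by (auto simp: nodal_def poly_prod)

lemma not_dvd_poly_nodal:
  assumes p: "prime p" and K: "finite K" "inj_on (\<lambda>i. i mod p) K" and j: "j \<in> K"
  shows "\<not> int p dvd poly (nodal K j) (int j)"
proof -
  have "\<not> int p dvd int j - int i" if "i \<in> K - {j}" for i
  proof
    assume "int p dvd int j - int i"
    then have "int j mod int p = int i mod int p" by (simp add: mod_eq_dvd_iff)
    then have "j mod p = i mod p" by (metis of_nat_eq_iff zmod_int)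
    then show False using K(2) j that by (auto dest: inj_onD)
  qed
  then show ?thesis
    using p K(1) by (auto simp: nodal_def poly_prod prime_dvd_prod_iff algebra_simps)
qed

section \<open>The system for the two parity classes\<close>

text \<open>Rows for \<open>K0\<close> use only the relations from \<open>A0\<close>. Rows for
  \<open>K1\<close> combine relations from \<open>A0\<close> and \<open>A1\<close> for the same
  polynomial so that the \<open>K0\<close> part cancels at w = 1; \<open>card K1 <= card K0\<close>
  keeps its degree below both numbers of nodes.\<close>

lemma two_block_kernel_trivial:
  fixes w :: complex and u :: "nat \<Rightarrow> complex"
  assumes p: "prime p" "odd p" and w: "w ^ p = 1"
    and K: "finite K0" "finite K1" "K0 \<inter> K1 = {}"
      "inj_on (\<lambda>j. j mod p) K0" "inj_on (\<lambda>j. j mod p) K1"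
    and A: "finite A0" "finite A1" "inj_on (\<lambda>a. w ^ a) A0" "inj_on (\<lambda>a. w ^ a) A1"
    and card: "card A0 = card K0" "card A1 = card K1" "card K1 \<le> card K0"
    and van0: "\<And>a. a \<in> A0 \<Longrightarrow> (\<Sum>j\<in>K0. u j * (w ^ a) ^ j) + (\<Sum>j\<in>K1. u j * (w ^ a) ^ j) = 0"
    and van1: "\<And>a. a \<in> A1 \<Longrightarrow> (\<Sum>j\<in>K0. u j * (w ^ a) ^ j) - (\<Sum>j\<in>K1. u j * (w ^ a) ^ j) = 0"
    and j: "j \<in> K0 \<union> K1"
  shows "u j = 0"
proof -
  let ?K = "K0 \<union> K1"
  \<comment> \<open>Changing the sign on \<open>K1\<close> turns the difference in
    \<open>van1\<close> into one sum over the union.\<close>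
  define u' where "u' j = (if j \<in> K1 then - u j else u j)" for j
  have fin: "finite ?K" using K by simp
  have v0: "(\<Sum>j\<in>?K. u j * (w ^ a) ^ j) = 0" if "a \<in> A0" for a
    using van0[OF that] K by (simp add: sum.union_disjoint)
  have v1: "(\<Sum>j\<in>?K. u' j * (w ^ a) ^ j) = 0" if "a \<in> A1" for a
  proof -
    have "(\<Sum>j\<in>K0. u' j * (w ^ a) ^ j) = (\<Sum>j\<in>K0. u j * (w ^ a) ^ j)"
      by (rule sum.cong) (use K in \<open>auto simp: u'_def\<close>)
    moreover have "(\<Sum>j\<in>K1. u' j * (w ^ a) ^ j) = - (\<Sum>j\<in>K1. u j * (w ^ a) ^ j)"
      by (simp add: u'_def flip: sum_negf)
    ultimately show ?thesis
      using van1[OF that] K by (simp add: sum.union_disjoint)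
  qed
  \<comment> \<open>A row for \<open>K0\<close> may have any values on \<open>K1\<close> at w = 1,
    while a row for \<open>K1\<close> must vanish there everywhere except at \<open>i\<close>: a
    block triangular pattern.\<close>
  have "\<exists>E. (\<Sum>j\<in>?K. u j * ev w (E j)) = 0 \<and> \<not> int p dvd poly (E i) 1 \<and>
      (\<forall>j\<in>K0. i \<noteq> j \<longrightarrow> poly (E j) 1 = 0) \<and> (i \<in> K1 \<longrightarrow> (\<forall>j\<in>K1. i \<noteq> j \<longrightarrow> poly (E j) 1 = 0))"
    if i: "i \<in> ?K" for i
  proof (cases "i \<in> K1")
    case False
    then have i: "i \<in> K0" using i by simp
    have "degree (nodal K0 i) < card A0" using degree_nodal K(1) i card by metis
    from vanishing_imp_relation[OF fin A(1,3) v0 this]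
    obtain E where "(\<Sum>j\<in>?K. u j * ev w (E j)) = 0" "\<And>j. poly (E j) 1 = poly (nodal K0 i) (int j)"
      by blast
    then show ?thesis
      using False not_dvd_poly_nodal[OF p(1) K(1,4) i] poly_nodal_eq_0[OF K(1)]
      by (intro exI[of _ E]) auto
  next
    case i: True
    have deg: "degree (nodal K1 i) < card A1" "degree (nodal K1 i) < card A0"
      using degree_nodal[OF K(2) i] card by auto
    from vanishing_imp_relation[OF fin A(1,3) v0 deg(2)]
    obtain E where E: "(\<Sum>j\<in>?K. u j * ev w (E j)) = 0" "\<And>j. poly (E j) 1 = poly (nodal K1 i) (int j)"
      by blast
    from vanishing_imp_relation[OF fin A(2,4) v1 deg(1)]
    obtain E' where E': "(\<Sum>j\<in>?K. u' j * ev w (E' j)) = 0" "\<And>j. poly (E' j) 1 = poly (nodal K1 i) (int j)"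
      by blast
    \<comment> \<open>The signs make \<open>u j * D j\<close> equal to
      \<open>u j * E j - u' j * E' j\<close>. As \<open>E\<close> and \<open>E'\<close> agree at w =
      1, \<open>D\<close> is zero there on \<open>K0\<close> and twice the nodal value on
      \<open>K1\<close>; the factor 2 is prime to the odd \<open>p\<close>.\<close>
    define D where "D j = (if j \<in> K1 then E j + E' j else E j - E' j)" for j
    have "(\<Sum>j\<in>?K. u j * ev w (D j)) = (\<Sum>j\<in>?K. u j * ev w (E j) - u' j * ev w (E' j))"
      by (rule sum.cong) (auto simp: D_def u'_def hom_distribs algebra_simps)
    also have "\<dots> = 0" by (simp add: sum_subtractf E(1) E'(1))
    finally have "(\<Sum>j\<in>?K. u j * ev w (D j)) = 0" .
    moreover have "\<not> int p dvd poly (D i) 1"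
    proof -
      have "\<not> int p dvd 2"
        using p primes_dvd_imp_eq[OF p(1) two_is_prime_nat] int_dvd_int_iff[of p 2] by auto
      then have "\<not> int p dvd 2 * poly (nodal K1 i) (int i)"
        using not_dvd_poly_nodal[OF p(1) K(2,5) i] p(1)
        by (simp add: prime_dvd_mult_iff)
      moreover have "poly (D i) 1 = 2 * poly (nodal K1 i) (int i)"
        using i by (simp add: D_def E E')
      ultimately show ?thesis by simp
    qed
    moreover have "poly (D j) 1 = 0" if "j \<in> K0" for j
      using that K(3) by (auto simp: D_def E E')
    moreover have "poly (D j) 1 = 0" if "j \<in> K1" "i \<noteq> j" for j
      using that poly_nodal_eq_0[OF K(2), of j i] by (simp add: D_def E E')
    ultimately show ?thesis by (intro exI[of _ D]) auto
  qed
  then have "\<exists>R. \<forall>i\<in>?K. (\<Sum>j\<in>?K. u j * ev w (R i j)) = 0 \<and> \<not> int p dvd poly (R i i) 1 \<and>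
      (\<forall>j\<in>K0. i \<noteq> j \<longrightarrow> poly (R i j) 1 = 0) \<and> (i \<in> K1 \<longrightarrow> (\<forall>j\<in>K1. i \<noteq> j \<longrightarrow> poly (R i j) 1 = 0))"
    by (intro bchoice) blast
  then obtain R where R: "\<And>i. i \<in> ?K \<Longrightarrow> (\<Sum>j\<in>?K. u j * ev w (R i j)) = 0"
      "\<And>i. i \<in> ?K \<Longrightarrow> \<not> int p dvd poly (R i i) 1"
      "\<And>i j. i \<in> ?K \<Longrightarrow> j \<in> K0 \<Longrightarrow> i \<noteq> j \<Longrightarrow> poly (R i j) 1 = 0"
      "\<And>i j. i \<in> K1 \<Longrightarrow> j \<in> K1 \<Longrightarrow> i \<noteq> j \<Longrightarrow> poly (R i j) 1 = 0"
    by auto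
  obtain xs0 where xs0: "set xs0 = K0" "distinct xs0" using finite_distinct_list[OF K(1)] by blast
  obtain xs1 where xs1: "set xs1 = K1" "distinct xs1" using finite_distinct_list[OF K(2)] by blast
  \<comment> \<open>Listing \<open>K0\<close> before \<open>K1\<close> turns the block pattern into
    an upper triangular matrix.\<close>
  define xs where "xs = xs0 @ xs1"
  have xs: "set xs = ?K" "distinct xs" using xs0 xs1 K(3) by (auto simp: xs_def)
  have nth: "xs ! m \<in> ?K" if "m < length xs" for m using that xs(1) nth_mem by metis
  obtain m where m: "m < length xs" "xs ! m = j" using j xs(1) by (metis in_set_conv_nth)
  have "u (xs ! m) = 0"
  proof (rule kernel_trivial_if_upper_triangular_at_1[OF p w,
        where R = "\<lambda>k l. R (xs ! k) (xs ! l)" and u = "\<lambda>l. u (xs ! l)" and N = "length xs"])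
    show "(\<Sum>l<length xs. ev w (R (xs ! k) (xs ! l)) * u (xs ! l)) = 0" if "k < length xs" for k
    proof -
      have "bij_betw ((!) xs) {..<length xs} ?K"
        using bij_betw_nth[OF xs(2)] xs(1) by simp
      then have "(\<Sum>l<length xs. ev w (R (xs ! k) (xs ! l)) * u (xs ! l)) =
          (\<Sum>j\<in>?K. ev w (R (xs ! k) j) * u j)"
        by (rule sum.reindex_bij_betw)
      then show ?thesis using R(1)[OF nth[OF that]] by (simp add: mult.commute)
    qed
    show "poly (R (xs ! k) (xs ! l)) 1 = 0" if "l < k" "k < length xs" for k l
    proof -
      have ne: "xs ! k \<noteq> xs ! l" using that xs(2) by (simp add: nth_eq_iff_index_eq)
      show ?thesis
      proof (cases "l < length xs0")
        case True
        then have "xs ! l \<in> K0" using xs0(1) by (auto simp: xs_def nth_append)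
        then show ?thesis using R(3)[OF nth[OF that(2)]] ne by simp
      next
        \<comment> \<open>Column \<open>l\<close> lies in the second block, hence so does row
          \<open>k\<close>, because \<open>l < k\<close>.\<close>
        case False
        then have "xs ! l \<in> K1" "xs ! k \<in> K1"
          using that xs1(1) by (auto simp: xs_def nth_append intro!: nth_mem)
        then show ?thesis using R(4) ne by simp
      qed
    qed
  qed (use m(1) R(2) nth in simp_all)
  then show ?thesis using m by simp
qed

section \<open>From the Fourier minor to the two-block system\<close>

text \<open>\<open>submatrix\<close> indexes by rank, so the kernel vector is carried back to
  \<open>J\<close> along the map sending \<open>j\<close> to the number of smaller elements of
  \<open>J\<close>.\<close>

lemma det_submatrix_eq_0_imp_kernel:
  fixes M :: "complex mat"
  assumes I: "I \<subseteq> {0..<dim_row M}" and J: "J \<subseteq> {0..<dim_col M}"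
    and card: "card I = card J" and det: "det (submatrix M I J) = 0"
  obtains u j where "j \<in> J" "u j \<noteq> 0" "\<And>i. i \<in> I \<Longrightarrow> (\<Sum>j\<in>J. M $$ (i, j) * u j) = 0"
proof -
  have fin: "finite I" "finite J" using I J finite_subset by blast+
  have eq: "{i. i < dim_row M \<and> i \<in> I} = I" "{j. j < dim_col M \<and> j \<in> J} = J" using I J by auto
  let ?r = "\<lambda>S i. card {a \<in> S. a < i}"
  have "submatrix M I J \<in> carrier_mat (card J) (card J)"
    by (rule carrier_matI) (simp_all add: dim_submatrix eq card)
  then obtain v where v: "v \<in> carrier_vec (card J)" "v \<noteq> 0\<^sub>v (card J)"
      "submatrix M I J *\<^sub>v v = 0\<^sub>v (card J)"
    using det det_0_iff_vec_prod_zero by blast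
  have bij: "bij_betw (?r J) J {..<card J}"
  proof (rule bij_betw_imageI)
    show inj: "inj_on (?r J) J" by (rule inj_on_inverseI[of _ "pick J"]) (rule pick_card_in_set)
    have "?r J ` J \<subseteq> {..<card J}"
      using fin(2) by (auto intro!: psubset_card_mono)
    then show "?r J ` J = {..<card J}"
      by (rule card_subset_eq[rotated]) (simp_all add: card_image[OF inj])
  qed
  obtain k where k: "k < card J" "v $ k \<noteq> 0"
    using v(1,2) by (metis carrier_vecD eq_vecI index_zero_vec(1) index_zero_vec(2))
  then have "k \<in> ?r J ` J" using bij by (simp add: bij_betw_def)
  then obtain j where j: "j \<in> J" "?r J j = k" by blast
  have "(\<Sum>j\<in>J. M $$ (i, j) * v $ ?r J j) = 0" if i: "i \<in> I" for i
  proof -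
    have ri: "?r I i < card J"
      unfolding card[symmetric] using fin(1) i by (auto intro!: psubset_card_mono)
    have "(\<Sum>j\<in>J. M $$ (i, j) * v $ ?r J j) = (\<Sum>j\<in>J. submatrix M I J $$ (?r I i, ?r J j) * v $ ?r J j)"
      using I J i by (intro sum.cong refl) (auto simp: submatrix_index_card subset_iff)
    also have "\<dots> = (\<Sum>l<card J. submatrix M I J $$ (?r I i, l) * v $ l)"
      by (rule sum.reindex_bij_betw[OF bij])
    also have "\<dots> = (submatrix M I J *\<^sub>v v) $ ?r I i"
      using ri v(1) by (simp add: scalar_prod_def dim_submatrix eq card atLeast0LessThan)
    finally show ?thesis using v(3) ri by simp
  qed
  then show ?thesis using that[of j "\<lambda>j. v $ ?r J j"] j k by simp
qed

lemma primitive_root_of_unity_inj_on: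
  assumes "primitive_root_of_unity n z"
  shows "inj_on (\<lambda>a. z ^ a) {0..<n}"
proof (rule linorder_inj_onI')
  fix a b assume ab: "a \<in> {0..<n}" "b \<in> {0..<n}" "a < b"
  have "z \<noteq> 0" using assms by (auto simp: primitive_root_of_unity_def power_0_left)
  moreover have "z ^ (b - a) \<noteq> 1" using assms ab by (simp add: primitive_root_of_unity_def)
  moreover have "z ^ b = z ^ a * z ^ (b - a)" using ab by (simp flip: power_add)
  ultimately show "z ^ a \<noteq> z ^ b" by simp
qed

theorem theoremA:
  fixes p n :: nat and \<zeta> :: complex and I J :: "nat set"
  assumes "prime p" and "odd p" and "n = 2 * p"
    and "primitive_root_of_unity n \<zeta>"
    and "I \<subseteq> {0..<n}" and "J \<subseteq> {0..<n}"
    and "\<forall>k\<in>{0, 1}. card (part_2 p I k) = card (part_2 p J k)"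
  shows "det (fourier_minor n \<zeta> I J) \<noteq> 0"
proof
  assume det: "det (fourier_minor n \<zeta> I J) = 0"
  note p = assms(1) assms(2)
  have p0: "p > 0" using p prime_gt_0_nat by blast
  have part0: "part_2 p S 0 = {i \<in> S. even i}" and part1: "part_2 p S 1 = {i \<in> S. odd i}"
    if "S \<subseteq> {0..<n}" for S
    using that component_2_eq_mod_2[OF p(2)] assms(3)
    by (auto simp: part_2_def subset_iff odd_iff_mod_2_eq_one)
  define I0 I1 J0 J1 where "I0 = {i \<in> I. even i}" and "I1 = {i \<in> I. odd i}"
    and "J0 = {i \<in> J. even i}" and "J1 = {i \<in> J. odd i}"
  note defs = I0_def I1_def J0_def J1_def
  have card: "card I0 = card J0" "card I1 = card J1"
    using assms(7) part0 part1 assms(5,6) by (auto simp: defs)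
  have fin: "finite I0" "finite I1" "finite J0" "finite J1"
    using assms(5,6) finite_subset[of _ "{0..<n}"] by (auto simp: defs)
  have un: "I = I0 \<union> I1" "J = J0 \<union> J1" "I0 \<inter> I1 = {}" "J0 \<inter> J1 = {}" by (auto simp: defs)
  have cardIJ: "card I = card J" using card fin un by (simp add: card_Un_disjoint)
  have dims: "dim_row (fourier_mat n \<zeta>) = n" "dim_col (fourier_mat n \<zeta>) = n"
    by (simp_all add: fourier_mat_def)
  obtain u j where j: "j \<in> J" "u j \<noteq> 0"
    and ker: "\<And>i. i \<in> I \<Longrightarrow> (\<Sum>j\<in>J. fourier_mat n \<zeta> $$ (i, j) * u j) = 0"
    by (rule det_submatrix_eq_0_imp_kernel[of I "fourier_mat n \<zeta>" J])
      (use assms(5,6) cardIJ det dims in \<open>simp_all add: fourier_minor_def\<close>)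
  \<comment> \<open>As \<open>p\<close> is odd and \<open>\<zeta> ^ p = -1\<close>, the sign change
    gives a p-th root of unity.\<close>
  define w where "w = - \<zeta>"
  have "\<zeta> ^ p \<noteq> 1" "(\<zeta> ^ p)\<^sup>2 = 1"
    using assms(3,4) p0 by (simp_all add: primitive_root_of_unity_def mult.commute flip: power_mult)
  then have "\<zeta> ^ p = - 1" by (auto simp: power2_eq_1_iff)
  then have w: "w ^ p = 1" using p(2) by (simp add: w_def)
  \<comment> \<open>Within one parity class \<open>w ^ a\<close> and \<open>\<zeta> ^ a\<close>
    differ by a fixed sign, so injectivity carries over from \<open>\<zeta>\<close>.\<close>
  have injw: "inj_on (\<lambda>a. w ^ a) I0" "inj_on (\<lambda>a. w ^ a) I1"
    using primitive_root_of_unity_inj_on[OF assms(4)] assms(5)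
    by (auto simp: inj_on_def w_def defs subset_iff power_minus_odd)
  \<comment> \<open>Equal parity and equal residue modulo \<open>p\<close> give congruence modulo
    \<open>2 * p\<close> by coprimality.\<close>
  have injm: "inj_on (\<lambda>i. i mod p) {i \<in> J. even i = b}" for b
  proof (rule inj_onI)
    fix x y assume xy: "x \<in> {i \<in> J. even i = b}" "y \<in> {i \<in> J. even i = b}" "x mod p = y mod p"
    have "x < 2 * p" "y < 2 * p" using xy assms(3,6) by auto
    moreover have "[x = y] (mod 2 * p)"
    proof (rule coprime_cong_mult_nat)
      show "[x = y] (mod 2)" using xy by (auto simp: cong_def mod2_eq_if)
      show "coprime 2 p" using p(2) by simp
    qed (use xy in \<open>simp add: cong_def\<close>)
    ultimately show "x = y" by (simp add: cong_def)
  qed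
  then have injm: "inj_on (\<lambda>i. i mod p) J0" "inj_on (\<lambda>i. i mod p) J1"
    using injm[of True] injm[of False] by (simp_all add: defs)
  have ent: "fourier_mat n \<zeta> $$ (i, j) = (-1) ^ (i * j) * (w ^ i) ^ j" if "i \<in> I" "j \<in> J" for i j
    using that assms(5,6)
    by (auto simp: fourier_mat_def w_def subset_iff power_mult[symmetric] power_mult_distrib[symmetric])
  let ?f = "\<lambda>K i. \<Sum>j\<in>K. u j * (w ^ i) ^ j"
  have v0: "?f J0 i + ?f J1 i = 0" if "i \<in> I0" for i
  proof -
    have "?f J0 i + ?f J1 i = (\<Sum>j\<in>J. u j * (w ^ i) ^ j)"
      using un fin by (simp add: sum.union_disjoint)
    also have "\<dots> = (\<Sum>j\<in>J. fourier_mat n \<zeta> $$ (i, j) * u j)"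
      using that by (intro sum.cong refl) (auto simp: ent defs)
    finally show ?thesis using ker that un by simp
  qed
  \<comment> \<open>For odd \<open>i\<close> the sign \<open>(-1) ^ (i * j)\<close> depends only on
    the parity of \<open>j\<close>, which produces the difference; for even \<open>i\<close> it is
    always 1.\<close>
  have v1: "?f J0 i - ?f J1 i = 0" if "i \<in> I1" for i
  proof -
    have iI: "i \<in> I" "odd i" using that by (auto simp: defs)
    have "?f J0 i = (\<Sum>j\<in>J0. fourier_mat n \<zeta> $$ (i, j) * u j)"
      using iI by (intro sum.cong refl) (auto simp: ent defs)
    moreover have "- ?f J1 i = (\<Sum>j\<in>J1. fourier_mat n \<zeta> $$ (i, j) * u j)"
      unfolding sum_negf[symmetric]
      using iI by (intro sum.cong refl) (auto simp: ent defs)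
    moreover have "(\<Sum>j\<in>J0. fourier_mat n \<zeta> $$ (i, j) * u j) + (\<Sum>j\<in>J1. fourier_mat n \<zeta> $$ (i, j) * u j)
        = (\<Sum>j\<in>J. fourier_mat n \<zeta> $$ (i, j) * u j)"
      using un fin by (simp add: sum.union_disjoint)
    ultimately show ?thesis using ker[OF iI(1)] by (metis diff_conv_add_uminus)
  qed
  show False
  proof (cases "card J1 \<le> card J0")
    case True
    have "u j = 0"
      by (rule two_block_kernel_trivial[OF p w fin(3,4) un(4) injm fin(1,2) injw card True])
        (use v0 v1 j(1) un(2) in \<open>simp_all only:\<close>)
    then show False using j by simp
  next
    case False
    \<comment> \<open>With the sign changed on \<open>J0\<close>, the sum of the two blocks is f_1 -
      f_0, vanishing for \<open>I1\<close>, and the difference is f_1 + f_0, vanishing for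
      \<open>I0\<close>. The parity classes thus exchange roles.\<close>
    define u' where "u' j = (if j \<in> J0 then - u j else u j)" for j
    have s0: "(\<Sum>j\<in>J0. u' j * (w ^ i) ^ j) = - ?f J0 i" for i
      by (simp add: u'_def flip: sum_negf)
    have s1: "(\<Sum>j\<in>J1. u' j * (w ^ i) ^ j) = ?f J1 i" for i
      by (rule sum.cong) (use un in \<open>auto simp: u'_def\<close>)
    have "u' j = 0"
    proof (rule two_block_kernel_trivial[OF p w fin(4,3) _ injm(2,1) fin(2,1) injw(2,1) card(2,1)])
      show "J1 \<inter> J0 = {}" using un(4) by blast
      show "card J0 \<le> card J1" using False by simp
      show "j \<in> J1 \<union> J0" using j(1) un(2) by blast
      show "(\<Sum>j\<in>J1. u' j * (w ^ i) ^ j) + (\<Sum>j\<in>J0. u' j * (w ^ i) ^ j) = 0" if "i \<in> I1" for i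
        using v1[OF that] by (simp add: s0 s1)
      show "(\<Sum>j\<in>J1. u' j * (w ^ i) ^ j) - (\<Sum>j\<in>J0. u' j * (w ^ i) ^ j) = 0" if "i \<in> I0" for i
        using v0[OF that] by (simp add: s0 s1 add.commute)
    qed
    then show False using j by (auto simp: u'_def split: if_splits)
  qed
qed

end
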